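(* Let $S$ be a finite non-empty set and $p:2^S\to\mathbb{Z}\cup\{-\infty\}$ a supermodular function with $p(\emptyset)=0$ and $p(S)$ finite; let $B=\{x\in\mathbb{R}^S:\widetilde x(S)=p(S),\ \widetilde x(Z)\ge p(Z)\ \forall Z\subseteq S\}$, let $\beta_1$ be the smallest integer for which $B\cap\mathbb{Z}^S$ has a $\beta_1$-covered element, let $h_1(X)=p(X)-(\beta_1-1)|X|$, and let the peak-set $S_1$ be the intersection of all subsets of $S$ maximizing $h_1$. Then for every pre-decreasingly minimal (and in particular every decreasingly minimal) element $m$ of $B\cap\mathbb{Z}^S$ we have $S_1(m)=S_1$, where $S_1(m)=\bigcup\{T_m(t): m(t)=\beta_1\}$; in particular $S_1(m)$ does not depend on the choice of $m$.
   Context: $\widetilde x(Z)=\sum_{s\in Z}x(s)$. A vector is $\beta$-covered if each of its components is at most $\beta$. For $m\in B$, $X$ is $m$-tight if $\widetilde m(X)=p(X)$, and $T_m(t)$ is the unique smallest $m$-tight set containing $t$. A $\beta_1$-covered element of $B\cap\mathbb{Z}^S$ is pre-decreasingly minimal if the number of its $\beta_1$-valued components is minimum among $\beta_1$-covered elements of $B\cap\mathbb{Z}^S$. An element $m$ of a set $Q$ is decreasingly minimal if its components sorted in decreasing order form a lexicographically smallest-or-equal sequence compared to every $y\in Q$ sorted likewise. *)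

theory Defs
  imports "HOL-Library.Extended_Real" "HOL-Library.FuncSet" "HOL-Library.Multiset"
begin

text \<open>
  A set function with values in the integers extended by minus infinity is represented as a
  function into \<^typ>\<open>ereal\<close>; vectors indexed by \<open>S\<close> are extensional functions on \<open>S\<close>.
\<close>

definition int_or_minfty_valued :: "'a set \<Rightarrow> ('a set \<Rightarrow> ereal) \<Rightarrow> bool" where
  "int_or_minfty_valued S p \<longleftrightarrow>
     (\<forall>X\<subseteq>S. p X = -\<infinity> \<or> (\<exists>k::int. p X = ereal (of_int k)))"

definition supermodular :: "'a set \<Rightarrow> ('a set \<Rightarrow> ereal) \<Rightarrow> bool" where
  "supermodular S p \<longleftrightarrow>
     (\<forall>X\<subseteq>S. \<forall>Y\<subseteq>S. p X + p Y \<le> p (X \<inter> Y) + p (X \<union> Y))"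

definition base_polyhedron :: "'a set \<Rightarrow> ('a set \<Rightarrow> ereal) \<Rightarrow> ('a \<Rightarrow> real) set" where
  "base_polyhedron S p =
     {x \<in> S \<rightarrow>\<^sub>E UNIV. ereal (sum x S) = p S \<and> (\<forall>Z\<subseteq>S. p Z \<le> ereal (sum x Z))}"

definition integral_base :: "'a set \<Rightarrow> ('a set \<Rightarrow> ereal) \<Rightarrow> ('a \<Rightarrow> real) set" where
  "integral_base S p = base_polyhedron S p \<inter> (S \<rightarrow>\<^sub>E \<int>)"

definition covered :: "'a set \<Rightarrow> real \<Rightarrow> ('a \<Rightarrow> real) \<Rightarrow> bool" where
  "covered S \<beta> x \<longleftrightarrow> (\<forall>s\<in>S. x s \<le> \<beta>)"

definition beta1 :: "'a set \<Rightarrow> ('a set \<Rightarrow> ereal) \<Rightarrow> int" where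
  "beta1 S p = (LEAST b. \<exists>x\<in>integral_base S p. covered S (of_int b) x)"

definition h1 :: "'a set \<Rightarrow> ('a set \<Rightarrow> ereal) \<Rightarrow> 'a set \<Rightarrow> ereal" where
  "h1 S p X = p X - ereal (of_int ((beta1 S p - 1) * int (card X)))"

definition peak_set :: "'a set \<Rightarrow> ('a set \<Rightarrow> ereal) \<Rightarrow> 'a set" where
  "peak_set S p = \<Inter>{X. X \<subseteq> S \<and> (\<forall>Y\<subseteq>S. h1 S p Y \<le> h1 S p X)}"

definition tight :: "'a set \<Rightarrow> ('a set \<Rightarrow> ereal) \<Rightarrow> ('a \<Rightarrow> real) \<Rightarrow> 'a set \<Rightarrow> bool" where
  "tight S p m X \<longleftrightarrow> X \<subseteq> S \<and> ereal (sum m X) = p X"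

text \<open>The \<open>LEAST\<close> here is with respect to set inclusion.\<close>

definition min_tight :: "'a set \<Rightarrow> ('a set \<Rightarrow> ereal) \<Rightarrow> ('a \<Rightarrow> real) \<Rightarrow> 'a \<Rightarrow> 'a set" where
  "min_tight S p m t = (LEAST X. tight S p m X \<and> t \<in> X)"

definition S1_of :: "'a set \<Rightarrow> ('a set \<Rightarrow> ereal) \<Rightarrow> ('a \<Rightarrow> real) \<Rightarrow> 'a set" where
  "S1_of S p m = \<Union>{min_tight S p m t |t. t \<in> S \<and> m t = of_int (beta1 S p)}"

definition pre_dec_min :: "'a set \<Rightarrow> ('a set \<Rightarrow> ereal) \<Rightarrow> ('a \<Rightarrow> real) \<Rightarrow> bool" where
  "pre_dec_min S p m \<longleftrightarrow>
     m \<in> integral_base S p \<and> covered S (of_int (beta1 S p)) m \<and>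
     (\<forall>y\<in>integral_base S p. covered S (of_int (beta1 S p)) y \<longrightarrow>
        card {s\<in>S. m s = of_int (beta1 S p)} \<le> card {s\<in>S. y s = of_int (beta1 S p)})"

definition decreasing_sort :: "'a set \<Rightarrow> ('a \<Rightarrow> real) \<Rightarrow> real list" where
  "decreasing_sort S x = rev (sorted_list_of_multiset (image_mset x (mset_set S)))"

definition dec_min :: "'a set \<Rightarrow> ('a \<Rightarrow> real) set \<Rightarrow> ('a \<Rightarrow> real) \<Rightarrow> bool" where
  "dec_min S Q m \<longleftrightarrow>
     m \<in> Q \<and> (\<forall>y\<in>Q. lexordp_eq (decreasing_sort S m) (decreasing_sort S y))"

end

theory Submission imports Defs begin

text \<open>
  Write \<open>\<beta>\<close> for \<open>\<beta>\<^sub>1\<close> and let \<open>m\<close> be pre-decreasingly minimal. If \<open>m t = \<beta>\<close> and \<open>s \<in> T\<^sub>m(t)\<close>, then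
  \<open>m s \<ge> \<beta> - 1\<close>, since otherwise moving one unit from \<open>t\<close> to \<open>s\<close> would stay in the base polyhedron
  and lower the number of \<open>\<beta>\<close>-valued components. For every \<open>X\<close>,
  \<open>h\<^sub>1(X) \<le> m(X) - (\<beta> - 1)|X| \<le> r\<close>, where \<open>r\<close> is the number of \<open>\<beta>\<close>-valued components, and
  \<open>S\<^sub>1(m)\<close> attains equality in both places. Conversely, equality forces \<open>X\<close> to be tight and to contain
  every \<open>\<beta>\<close>-valued \<open>t\<close>, hence every \<open>T\<^sub>m(t)\<close>. So \<open>S\<^sub>1(m)\<close> is the smallest maximizer of \<open>h\<^sub>1\<close>.
\<close>

lemma integral_baseD:
  assumes "m \<in> integral_base S p"
  shows "m \<in> S \<rightarrow>\<^sub>E \<int>" "ereal (sum m S) = p S" "Z \<subseteq> S \<Longrightarrow> p Z \<le> ereal (sum m Z)"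
  using assms by (auto simp: integral_base_def base_polyhedron_def)

text \<open>Uncrossing: supermodularity bounds \<open>sum m X + sum m Y\<close> by the values of
  \<open>p\<close> on the intersection and the union, and the base constraints bound these by the
  same total, so both constraints hold with equality.\<close>

lemma tight_Int_Un:
  assumes fin: "finite S" and sm: "supermodular S p" and m: "m \<in> integral_base S p"
    and X: "tight S p m X" and Y: "tight S p m Y"
  shows "tight S p m (X \<inter> Y)" "tight S p m (X \<union> Y)"
proof -
  have sub: "X \<subseteq> S" "Y \<subseteq> S" and eq: "p X = ereal (sum m X)" "p Y = ereal (sum m Y)"
    using X Y by (auto simp: tight_def)
  have super: "ereal (sum m X + sum m Y) \<le> p (X \<inter> Y) + p (X \<union> Y)"
    using sm sub eq unfolding supermodular_def by (metis plus_ereal.simps(1))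
  have le: "p (X \<inter> Y) \<le> ereal (sum m (X \<inter> Y))" "p (X \<union> Y) \<le> ereal (sum m (X \<union> Y))"
    using integral_baseD(3)[OF m] sub by (simp_all add: le_infI1)
  have sums: "sum m X + sum m Y = sum m (X \<inter> Y) + sum m (X \<union> Y)"
    using sum.union_inter[of X Y m] fin sub by (simp add: finite_subset add.commute)
  \<comment> \<open>An infinite value would contradict \<open>super\<close> or \<open>le\<close>, so
    the squeeze takes place among reals.\<close>
  have "p (X \<inter> Y) = ereal (sum m (X \<inter> Y)) \<and> p (X \<union> Y) = ereal (sum m (X \<union> Y))"
    using super le sums
    by (cases "p (X \<inter> Y)"; cases "p (X \<union> Y)") auto
  then show "tight S p m (X \<inter> Y)" "tight S p m (X \<union> Y)"
    using sub by (auto simp: tight_def)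
qed

lemma tight_Inter:
  assumes "finite S" "supermodular S p" "m \<in> integral_base S p"
    and "finite F" "F \<noteq> {}" "\<And>X. X \<in> F \<Longrightarrow> tight S p m X"
  shows "tight S p m (\<Inter>F)"
  using assms(4-6) by (induction F rule: finite_ne_induct) (auto intro: tight_Int_Un assms(1-3))

lemma tight_Union:
  assumes "finite S" "supermodular S p" "m \<in> integral_base S p" "p {} = 0"
    and "finite F" "\<And>X. X \<in> F \<Longrightarrow> tight S p m X"
  shows "tight S p m (\<Union>F)"
  using assms(5,6)
  by (induction F rule: finite_induct)
    (auto intro: tight_Int_Un assms(1-3) simp: tight_def[of S p m "{}"] assms(4) zero_ereal_def)

text \<open>The tight sets containing \<open>t\<close> form a finite family, nonempty since
  \<open>S\<close> is tight and closed under intersection. Its intersection is thus its least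
  member, which gives the \<open>LEAST\<close> a meaning.\<close>

lemma min_tight:
  assumes fin: "finite S" and sm: "supermodular S p" and m: "m \<in> integral_base S p"
    and t: "t \<in> S"
  shows "tight S p m (min_tight S p m t)" "t \<in> min_tight S p m t"
    and "\<And>X. tight S p m X \<Longrightarrow> t \<in> X \<Longrightarrow> min_tight S p m t \<subseteq> X"
proof -
  let ?F = "{X. tight S p m X \<and> t \<in> X}"
  have "?F \<subseteq> Pow S" by (auto simp: tight_def)
  then have "finite ?F" using fin by (meson finite_Pow_iff finite_subset)
  moreover have "S \<in> ?F" using t integral_baseD(2)[OF m] by (auto simp: tight_def)
  ultimately have "tight S p m (\<Inter>?F)" by (intro tight_Inter[OF fin sm m]) auto
  moreover from this have "min_tight S p m t = \<Inter>?F"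
    unfolding min_tight_def by (intro Least_equality) auto
  ultimately show "tight S p m (min_tight S p m t)" "t \<in> min_tight S p m t"
    "\<And>X. tight S p m X \<Longrightarrow> t \<in> X \<Longrightarrow> min_tight S p m t \<subseteq> X" by auto
qed

text \<open>Moving one unit from \<open>t\<close> to \<open>s\<close> lowers only the sums over sets
  containing \<open>t\<close> but not \<open>s\<close>, each by one. Such sets are not tight, so
  integrality gives them slack at least one.\<close>

lemma integral_base_exchange:
  assumes fin: "finite S" and int: "int_or_minfty_valued S p" and m: "m \<in> integral_base S p"
    and s: "s \<in> S" and t: "t \<in> S" and "s \<noteq> t"
    and nt: "\<And>X. tight S p m X \<Longrightarrow> t \<in> X \<Longrightarrow> s \<in> X"
  shows "m(s := m s + 1, t := m t - 1) \<in> integral_base S p"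
proof -
  let ?y = "m(s := m s + 1, t := m t - 1)"
  have eq: "?y = (\<lambda>u. m u + ((if u = s then 1 else 0) - (if u = t then 1 else 0)))"
    using \<open>s \<noteq> t\<close> by auto
  have sum_y: "sum ?y Z = sum m Z + ((if s \<in> Z then 1 else 0) - (if t \<in> Z then 1 else 0))"
    if "Z \<subseteq> S" for Z
    using finite_subset[OF that fin] unfolding eq by (simp add: sum.distrib sum_subtractf)
  have mE: "m \<in> S \<rightarrow>\<^sub>E \<int>" by (rule integral_baseD(1)[OF m])
  have yE: "?y \<in> S \<rightarrow>\<^sub>E \<int>"
    using mE s t by (auto simp: PiE_iff extensional_def)
  have "p Z \<le> ereal (sum ?y Z)" if Z: "Z \<subseteq> S" for Z
  proof (cases "t \<in> Z \<and> s \<notin> Z")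
    case False
    then have "sum m Z \<le> sum ?y Z" using sum_y[OF Z] by auto
    then show ?thesis using integral_baseD(3)[OF m Z] by (meson ereal_less_eq(3) order_trans)
  next
    case True
    then have "\<not> tight S p m Z" using nt by auto
    then have less: "p Z < ereal (sum m Z)"
      using integral_baseD(3)[OF m Z] Z by (auto simp: tight_def less_le)
    have "sum m Z \<in> \<int>" using mE Z by (intro Ints_sum) auto
    then obtain a :: int where a: "sum m Z = of_int a" by (auto elim: Ints_cases)
    have "p Z = -\<infinity> \<or> (\<exists>k::int. p Z = ereal (of_int k))"
      using int Z by (auto simp: int_or_minfty_valued_def)
    then show ?thesis using True less unfolding sum_y[OF Z] a
      by (auto simp: int_le_real_less)
  qed
  moreover have "ereal (sum ?y S) = p S"
    using sum_y[of S] s t integral_baseD(2)[OF m] by simp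
  ultimately show ?thesis
    using yE by (auto simp: integral_base_def base_polyhedron_def PiE_iff)
qed

lemma min_tight_value_ge:
  assumes fin: "finite S" and int: "int_or_minfty_valued S p" and sm: "supermodular S p"
    and m: "pre_dec_min S p m"
    and t: "t \<in> S" "m t = of_int (beta1 S p)" and s: "s \<in> min_tight S p m t"
  shows "of_int (beta1 S p) - 1 \<le> m s"
proof (rule ccontr)
  let ?b = "of_int (beta1 S p) :: real"
  let ?y = "m(s := m s + 1, t := m t - 1)"
  assume "\<not> ?b - 1 \<le> m s"
  then have lt: "m s + 1 < ?b" by simp
  then have "s \<noteq> t" using t by auto
  have mB: "m \<in> integral_base S p" and cov: "covered S ?b m"
    using m by (auto simp: pre_dec_min_def)
  have "s \<in> S" using s min_tight(1)[OF fin sm mB t(1)] by (auto simp: tight_def)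
  have "?y \<in> integral_base S p"
    using min_tight(3)[OF fin sm mB t(1)] s
    by (intro integral_base_exchange[OF fin int mB \<open>s \<in> S\<close> t(1) \<open>s \<noteq> t\<close>]) auto
  moreover have "covered S ?b ?y"
    using cov lt t by (auto simp: covered_def)
  ultimately have "card {u\<in>S. m u = ?b} \<le> card {u\<in>S. ?y u = ?b}"
    using m unfolding pre_dec_min_def by blast
  \<comment> \<open>\<open>t\<close> leaves the set, and \<open>s\<close> does not enter it because
    \<open>m s + 1\<close> is still below \<open>?b\<close>.\<close>
  moreover have "{u\<in>S. ?y u = ?b} \<subset> {u\<in>S. m u = ?b}"
    using lt t by (auto split: if_splits)
  ultimately show False
    using psubset_card_mono[of "{u\<in>S. m u = ?b}" "{u\<in>S. ?y u = ?b}"] fin by simp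
qed

lemma S1_of_eq_peak_set:
  assumes fin: "finite S" and int: "int_or_minfty_valued S p" and sm: "supermodular S p"
    and p0: "p {} = 0" and m: "pre_dec_min S p m"
  shows "S1_of S p m = peak_set S p"
proof -
  let ?b = "of_int (beta1 S p) :: real"
  let ?K = "{t\<in>S. m t = ?b}"
  let ?T = "S1_of S p m"
  have mB: "m \<in> integral_base S p" and cov: "covered S ?b m"
    using m by (auto simp: pre_dec_min_def)
  have T: "?T = \<Union>(min_tight S p m ` ?K)" by (auto simp: S1_of_def)
  have tightT: "tight S p m ?T"
    unfolding T using fin min_tight(1)[OF fin sm mB] by (intro tight_Union[OF fin sm mB p0]) auto
  then have TS: "?T \<subseteq> S" by (simp add: tight_def)
  have KT: "?K \<subseteq> ?T" unfolding T using min_tight(2)[OF fin sm mB] by auto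
  \<comment> \<open>Integrality leaves no value strictly between \<open>?b - 1\<close> and
    \<open>?b\<close>.\<close>
  have mT: "m s = ?b - 1" if s: "s \<in> ?T" "s \<notin> ?K" for s
  proof -
    have "?b - 1 \<le> m s" using s min_tight_value_ge[OF fin int sm m] by (auto simp: T)
    moreover have "m s < ?b" using s TS cov by (force simp: covered_def less_le)
    moreover have "m s \<in> \<int>" using integral_baseD(1)[OF mB] s TS by auto
    ultimately show ?thesis by (auto elim!: Ints_cases)
  qed
  have low: "m s \<le> ?b - 1" if "s \<in> S" "s \<notin> ?K" for s
  proof -
    have "m s < ?b" using that cov by (force simp: covered_def less_le)
    moreover have "m s \<in> \<int>" using integral_baseD(1)[OF mB] that by auto
    ultimately show ?thesis by (auto elim!: Ints_cases)
  qed
  \<comment> \<open>The cardinality term of \<open>h1\<close> is absorbed by subtracting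
    \<open>?b - 1\<close> from each component. If \<open>p X\<close> is minus infinity, both sides
    of the equivalence are false.\<close>
  have h1_le: "h1 S p X \<le> ereal (\<Sum>s\<in>X. m s - (?b - 1))"
    and h1_tight: "h1 S p X = ereal (\<Sum>s\<in>X. m s - (?b - 1)) \<longleftrightarrow> tight S p m X" if "X \<subseteq> S" for X
  proof -
    have "(\<Sum>s\<in>X. m s - (?b - 1)) = sum m X - of_int ((beta1 S p - 1) * int (card X))"
      by (simp add: sum_subtractf mult.commute)
    then show "h1 S p X \<le> ereal (\<Sum>s\<in>X. m s - (?b - 1))"
      "h1 S p X = ereal (\<Sum>s\<in>X. m s - (?b - 1)) \<longleftrightarrow> tight S p m X"
      using integral_baseD(3)[OF mB that] that
      by (cases "p X"; auto simp: h1_def tight_def)+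
  qed
  \<comment> \<open>A component equal to \<open>?b\<close> contributes one, any other at most
    zero.\<close>
  have sum_le: "(\<Sum>s\<in>X. m s - (?b - 1)) \<le> card (X \<inter> ?K)" if "X \<subseteq> S" for X
  proof -
    have "(\<Sum>s\<in>X. m s - (?b - 1)) \<le> (\<Sum>s\<in>X. if s \<in> ?K then 1 else 0)"
      using low that by (intro sum_mono) auto
    also have "\<dots> = card (X \<inter> ?K)"
      using finite_subset[OF that fin] by (simp add: sum.If_cases Int_def)
    finally show ?thesis .
  qed
  \<comment> \<open>On \<open>?T\<close> the other components contribute exactly zero by
    \<open>mT\<close>.\<close>
  have "(\<Sum>s\<in>?T. m s - (?b - 1)) = (\<Sum>s\<in>?T. if s \<in> ?K then 1 else 0)"
    using mT by (intro sum.cong) auto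
  also have "\<dots> = card (?T \<inter> ?K)"
    using finite_subset[OF TS fin] by (simp add: sum.If_cases Int_def)
  also have "?T \<inter> ?K = ?K" using KT by auto
  finally have h1T: "h1 S p ?T = ereal (card ?K)"
    using h1_tight[OF TS] tightT by simp
  have cardK: "card (X \<inter> ?K) \<le> card ?K" for X
    using fin by (intro card_mono) auto
  have maxT: "h1 S p Y \<le> h1 S p ?T" if "Y \<subseteq> S" for Y
  proof -
    have "h1 S p Y \<le> ereal (card (Y \<inter> ?K))"
      using h1_le[OF that] sum_le[OF that] by (meson ereal_less_eq(3) order_trans)
    also have "\<dots> \<le> ereal (card ?K)" using cardK by simp
    finally show ?thesis unfolding h1T .
  qed
  have leastT: "?T \<subseteq> X" if X: "X \<subseteq> S" and max: "\<forall>Y\<subseteq>S. h1 S p Y \<le> h1 S p X" for X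
  proof -
    \<comment> \<open>A maximizer reaches the upper bound \<open>card ?K\<close>, so
      \<open>sum_le\<close> and \<open>h1_le\<close> both become equalities: the former puts
      \<open>?K\<close> inside \<open>X\<close>, the latter makes \<open>X\<close> tight.\<close>
    have ge: "ereal (card ?K) \<le> h1 S p X" using max TS h1T by metis
    then have "card ?K \<le> (\<Sum>s\<in>X. m s - (?b - 1))"
      using h1_le[OF X] by (meson ereal_less_eq(3) order_trans)
    then have "real (card ?K) \<le> real (card (X \<inter> ?K))" using sum_le[OF X] by linarith
    then have eqK: "X \<inter> ?K = ?K"
      using fin cardK[of X] by (intro card_subset_eq) auto
    have "(\<Sum>s\<in>X. m s - (?b - 1)) \<le> card ?K" using sum_le[OF X] unfolding eqK .
    then have "h1 S p X = ereal (\<Sum>s\<in>X. m s - (?b - 1))"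
      using ge h1_le[OF X] by (meson ereal_less_eq(3) order_antisym order_trans)
    then have "tight S p m X" using h1_tight[OF X] by simp
    then show ?thesis unfolding T using min_tight(3)[OF fin sm mB] eqK by blast
  qed
  show ?thesis
    unfolding peak_set_def using TS maxT leastT by (intro antisym) blast+
qed

text \<open>The integers are not well-ordered, so the \<open>LEAST\<close> in \<open>beta1\<close>
  needs a lower bound on the covering values as well as one such value.\<close>

lemma beta1_attained:
  assumes fin: "finite S" and ne: "S \<noteq> {}" and m: "m \<in> integral_base S p"
  shows "\<exists>x\<in>integral_base S p. covered S (of_int (beta1 S p)) x"
proof -
  let ?P = "\<lambda>b::int. \<exists>x\<in>integral_base S p. covered S (of_int b) x"
  \<comment> \<open>All members of the base have the same total, so no covering value is below the
    average component.\<close>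
  define a where "a = \<lfloor>sum m S / card S\<rfloor>"
  have card: "real (card S) > 0" using fin ne by (simp add: card_gt_0_iff)
  have lower: "a \<le> b" if "?P b" for b
  proof -
    from that obtain x where x: "x \<in> integral_base S p" "covered S (of_int b) x" by blast
    have "sum m S = sum x S"
      using integral_baseD(2)[OF m] integral_baseD(2)[OF x(1)] by (metis ereal.inject)
    also have "\<dots> \<le> real (card S) * of_int b"
      using x(2) by (intro sum_bounded_above) (auto simp: covered_def)
    finally have "sum m S / card S \<le> of_int b" using card by (simp add: field_simps)
    then show ?thesis unfolding a_def by linarith
  qed
  have "covered S (of_int \<lceil>Max (m ` S)\<rceil>) m"
    unfolding covered_def using fin
    by (meson Max_ge finite_imageI imageI le_of_int_ceiling order_trans)
  then obtain c where c: "?P c" using m by blast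
  \<comment> \<open>Shifting by \<open>a\<close> moves the search to the naturals, where a least
    element exists.\<close>
  let ?Q = "\<lambda>n. ?P (a + int n)"
  have "?Q (nat (c - a))" using c lower[OF c] by simp
  then have Q: "?Q (LEAST n. ?Q n)" by (rule LeastI)
  have "beta1 S p = a + int (LEAST n. ?Q n)"
    unfolding beta1_def
  proof (rule Least_equality)
    show "?Q (LEAST n. ?Q n)" by (rule Q)
  next
    fix b assume b: "?P b"
    then have "?Q (nat (b - a))" using lower[OF b] by simp
    then have "(LEAST n. ?Q n) \<le> nat (b - a)" by (rule Least_le)
    then show "a + int (LEAST n. ?Q n) \<le> b" using lower[OF b] by simp
  qed
  then show ?thesis using Q by simp
qed

text \<open>Up to the first difference the lists agree; from there on \<open>xs\<close> has no entry
  \<open>b\<close>. If \<open>xs\<close> ends first, \<open>ys\<close> can only have more.\<close>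

lemma lexordp_eq_decreasing_count:
  fixes xs ys :: "'b::linorder list"
  assumes "lexordp_eq xs ys" "sorted_wrt (\<ge>) xs" "\<forall>y\<in>set ys. y \<le> b"
  shows "(\<forall>x\<in>set xs. x \<le> b) \<and> count (mset xs) b \<le> count (mset ys) b"
  using assms
proof (induction rule: lexordp_eq.induct)
  case (Cons x y xs ys)
  \<comment> \<open>Here \<open>x < y \<le> b\<close>, and no later entry of the nonincreasing list
    exceeds \<open>x\<close>.\<close>
  then have "\<forall>z\<in>set (x # xs). z < b" by auto
  moreover from this have "count (mset (x # xs)) b = 0"
    unfolding count_mset_0_iff by blast
  ultimately show ?case by (auto simp: less_imp_le)
qed auto

lemma dec_min_imp_pre_dec_min:
  assumes fin: "finite S" and ne: "S \<noteq> {}" and m: "dec_min S (integral_base S p) m"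
  shows "pre_dec_min S p m"
proof -
  let ?b = "of_int (beta1 S p) :: real"
  have mB: "m \<in> integral_base S p" using m by (simp add: dec_min_def)
  have mset_sort: "mset (decreasing_sort S x) = image_mset x (mset_set S)" for x
    by (simp add: decreasing_sort_def)
  have set_sort: "set (decreasing_sort S x) = x ` S" for x
    using fin by (simp add: mset_sort flip: set_mset_mset)
  have count_sort: "count (mset (decreasing_sort S x)) ?b = card {s\<in>S. x s = ?b}" for x
    unfolding mset_sort using fin by (simp add: count_image_mset' eq_commute)
  have key: "covered S ?b m \<and> card {s\<in>S. m s = ?b} \<le> card {s\<in>S. y s = ?b}"
    if "y \<in> integral_base S p" "covered S ?b y" for y
  proof -
    have "sorted_wrt (\<ge>) (decreasing_sort S m)"
      by (simp add: decreasing_sort_def sorted_wrt_rev sorted_sorted_list_of_multiset)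
    moreover have "lexordp_eq (decreasing_sort S m) (decreasing_sort S y)"
      using m that by (simp add: dec_min_def)
    moreover have "\<forall>v\<in>set (decreasing_sort S y). v \<le> ?b"
      using that(2) by (simp add: set_sort covered_def)
    ultimately show ?thesis
      using lexordp_eq_decreasing_count[of "decreasing_sort S m" "decreasing_sort S y" ?b]
      unfolding count_sort set_sort covered_def by blast
  qed
  \<comment> \<open>\<open>beta1_attained\<close> supplies a covered competitor, from which
    \<open>key\<close> derives that \<open>m\<close> itself is covered.\<close>
  then show ?thesis
    using beta1_attained[OF fin ne mB] mB unfolding pre_dec_min_def by blast
qed

theorem theorem4p4:
  fixes S :: "'a set" and p :: "'a set \<Rightarrow> ereal"
  assumes "finite S" and "S \<noteq> {}"
    and "int_or_minfty_valued S p"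
    and "supermodular S p"
    and "p {} = 0"
    and "\<bar>p S\<bar> \<noteq> \<infinity>"
  shows "(\<forall>m. pre_dec_min S p m \<longrightarrow> S1_of S p m = peak_set S p)
    \<and> (\<forall>m. dec_min S (integral_base S p) m \<longrightarrow>
          pre_dec_min S p m \<and> S1_of S p m = peak_set S p)
    \<and> (\<forall>m m'. pre_dec_min S p m \<and> pre_dec_min S p m' \<longrightarrow> S1_of S p m = S1_of S p m')"
  using S1_of_eq_peak_set[OF assms(1,3-5)] dec_min_imp_pre_dec_min[OF assms(1,2)] by blast

end
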